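(* Let $\mathcal{A}$ be a family with $\{F_2,F_3\}\subseteq\mathcal{A}\subseteq\{F_2,F_3,F_4,F_5,F_7\}$. Then $\mathrm{ex}(n,\mathcal{A})=\Theta(n^2)$ as $n\to\infty$.
   Context: A triple system $H=(V,E)$ has a finite vertex set $V$, and $E$ is a set of $3$-element subsets of $V$ (no repeated triples). For a family $\mathcal{H}$ of triple systems, $\mathrm{ex}(n,\mathcal{H})$ is the maximum number of triples in a triple system on $n$ vertices that does not contain (an isomorphic copy of) any member of $\mathcal{H}$ as a (not necessarily induced) subsystem. A special four cycle has four distinct base vertices $v_1,v_2,v_3,v_4$ and four triples $\{w_i,v_i,v_{i+1}\}$, $i=1,2,3,4$ (indices modulo $4$), where the $w_j$ are not necessarily distinct but $w_i\neq v_j$ for all $1\le i,j\le 4$. Up to isomorphism there are seven, $F_1,\dots,F_7$, given by exactly the following coincidences among the $w_j$ (no other coincidences): $F_1$: all $w_j$ different; $F_2$: $w_1=w_2=w_3=w_4$; $F_3$: $w_1=w_2$ and $w_3=w_4$; $F_4$: $w_1=w_3$ and $w_2=w_4$ (the Pasch configuration); $F_5$: $w_1=w_2=w_3$; $F_6$: $w_1=w_3$; $F_7$: $w_1=w_2$. *)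

theory Defs
  imports Complex_Main "HOL-Library.Landau_Symbols"
begin

type_synonym 'a triple_sys = "'a set \<times> 'a set set"

abbreviation verts :: "'a triple_sys \<Rightarrow> 'a set" where "verts \<equiv> fst"
abbreviation triples :: "'a triple_sys \<Rightarrow> 'a set set" where "triples \<equiv> snd"

definition triple_system :: "'a triple_sys \<Rightarrow> bool" where
  "triple_system H \<longleftrightarrow> finite (verts H) \<and> (\<forall>e \<in> triples H. e \<subseteq> verts H \<and> card e = 3)"

definition subsystem :: "'a triple_sys \<Rightarrow> 'a triple_sys \<Rightarrow> bool" where
  "subsystem G H \<longleftrightarrow> triple_system G \<and> verts G \<subseteq> verts H \<and> triples G \<subseteq> triples H"

definition isomorphic :: "'a triple_sys \<Rightarrow> 'b triple_sys \<Rightarrow> bool" where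
  "isomorphic F G \<longleftrightarrow>
     (\<exists>f. bij_betw f (verts F) (verts G) \<and> (\<lambda>e. f ` e) ` triples F = triples G)"

definition contains :: "'a triple_sys \<Rightarrow> 'b triple_sys \<Rightarrow> bool" where
  "contains H F \<longleftrightarrow> (\<exists>G. subsystem G H \<and> isomorphic F G)"

text \<open>Host systems live on finite sets of naturals, which loses no generality up to isomorphism.
  The set below is finite, and it is nonempty as soon as every member of the family has a triple;
  otherwise the maximum may be unspecified.\<close>

definition ex_number :: "nat \<Rightarrow> 'b triple_sys set \<Rightarrow> nat" where
  "ex_number n \<A> = Max {card (triples H) | H :: nat triple_sys.
     triple_system H \<and> card (verts H) = n \<and> (\<forall>F \<in> \<A>. \<not> contains H F)}"

text \<open>The base vertices are 0, 1, 2, 3, and the entries of the list, which should be of length 4 and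
  avoid the base vertices, are the third vertices \<open>w\<^sub>1, \<dots>, w\<^sub>4\<close> in cyclic order (indices shifted by one).\<close>

definition special_four_cycle :: "nat list \<Rightarrow> nat triple_sys" where
  "special_four_cycle w =
     ({..<4} \<union> set w, (\<lambda>i. {w ! i, i, (i + 1) mod 4}) ` {..<4})"

definition F2 :: "nat triple_sys" where "F2 = special_four_cycle [4, 4, 4, 4]"
definition F3 :: "nat triple_sys" where "F3 = special_four_cycle [4, 4, 5, 5]"
definition F4 :: "nat triple_sys" where "F4 = special_four_cycle [4, 5, 4, 5]"
definition F5 :: "nat triple_sys" where "F5 = special_four_cycle [4, 4, 4, 5]"
definition F7 :: "nat triple_sys" where "F7 = special_four_cycle [4, 4, 5, 6]"

end

theory Submission
  imports Defs
begin

text \<open>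
  Write the triples of a system as pairs \<open>(P, v)\<close> of a two-element set \<open>P\<close> and a third vertex \<open>v\<close>, and
  view this as a bipartite graph between two-element sets and vertices. A four-cycle in this graph
  consists of sets \<open>P \<noteq> Q\<close> and vertices \<open>x \<noteq> y\<close> each of which completes both \<open>P\<close> and \<open>Q\<close> to a
  triple. If \<open>P\<close> and \<open>Q\<close> share a vertex this is a copy of \<open>F\<^sub>2\<close>, and if they are disjoint it is a copy
  of \<open>F\<^sub>3\<close> (lemma \<open>common_completions_contain_F2_or_F3\<close>). So forbidding \<open>F\<^sub>2\<close> and \<open>F\<^sub>3\<close> makes the
  bipartite graph free of four-cycles: a pair \<open>{x, y}\<close> of common completions determines \<open>P\<close>. Hence
  each triple can be charged to a two-element subset of the vertex set in such a way that every
  subset is charged at most twice, and there are at most \<open>n\<^sup>2\<close> triples.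

  For the lower bound, each of \<open>F\<^sub>2, F\<^sub>3, F\<^sub>5, F\<^sub>7\<close> has two triples with two common vertices, so a linear
  system contains none of them, and only the Pasch configuration \<open>F\<^sub>4\<close> is left to be avoided. The
  addition table of the integers \<open>0, \<dots>, m - 1\<close>, read as a tripartite system of triples (row, column,
  sum), is linear, and it has no Pasch configuration: that would be a Latin subsquare of order two, hence
  a nonzero integer equal to its own negative. It has \<open>m\<^sup>2\<close> triples on \<open>4 m\<close> vertices.
\<close>

section \<open>Containment as an injective map\<close>

lemma contains_iff_inj_map:
  assumes F: "triple_system F" and H: "triple_system H"
  shows "contains H F \<longleftrightarrow>
    (\<exists>f. inj_on f (verts F) \<and> f ` verts F \<subseteq> verts H \<and> (\<forall>e \<in> triples F. f ` e \<in> triples H))"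
    (is "_ \<longleftrightarrow> ?R")
proof
  assume "contains H F"
  then obtain G f where "subsystem G H" and "bij_betw f (verts F) (verts G)"
    and "(\<lambda>e. f ` e) ` triples F = triples G"
    by (auto simp: contains_def isomorphic_def)
  then have "inj_on f (verts F) \<and> f ` verts F \<subseteq> verts H \<and> (\<forall>e \<in> triples F. f ` e \<in> triples H)"
    unfolding subsystem_def bij_betw_def by blast
  then show ?R by blast
next
  assume ?R
  then obtain f where f: "inj_on f (verts F)" "f ` verts F \<subseteq> verts H"
    "\<forall>e \<in> triples F. f ` e \<in> triples H" by blast
  let ?G = "(f ` verts F, (\<lambda>e. f ` e) ` triples F)"
  have "subsystem ?G H"
    using f F H by (auto simp: subsystem_def triple_system_def) blast
  moreover have "isomorphic F ?G"
    using f(1) by (auto simp: isomorphic_def bij_betw_def)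
  ultimately show "contains H F"
    unfolding contains_def by blast
qed

lemma triples_special_four_cycle:
  "triples (special_four_cycle [a, b, c, d]) = {{a, 0, 1}, {b, 1, 2}, {c, 2, 3}, {d, 3, 0}}"
proof -
  have "{..<4} = {0, 1, 2, 3 :: nat}" by auto
  then show ?thesis by (simp add: special_four_cycle_def flip: numeral_2_eq_2)
qed

lemma verts_special_four_cycle:
  "verts (special_four_cycle [a, b, c, d]) = {0, 1, 2, 3, a, b, c, d}"
  by (auto simp: special_four_cycle_def)

lemma triple_system_special_four_cycle:
  assumes "4 \<le> a" "4 \<le> b" "4 \<le> c" "4 \<le> d"
  shows "triple_system (special_four_cycle [a, b, c, d])"
  unfolding triple_system_def triples_special_four_cycle verts_special_four_cycle
  using assms by (auto simp: card_insert_if)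

section \<open>The upper bound\<close>

text \<open>The vertices \<open>x\<close> and \<open>y\<close> become opposite base vertices. A vertex shared by \<open>P\<close> and \<open>Q\<close> has to be
  the apex of all four triples; in the disjoint case either vertex of \<open>P\<close> and of \<open>Q\<close> may serve as
  apex.\<close>

lemma common_completions_contain_F2_or_F3:
  assumes H: "triple_system H"
    and PQ: "card P = 2" "card Q = 2" "P \<noteq> Q"
    and xy: "x \<noteq> y" "x \<notin> P" "x \<notin> Q" "y \<notin> P" "y \<notin> Q"
    and E: "insert x P \<in> triples H" "insert y P \<in> triples H"
      "insert x Q \<in> triples H" "insert y Q \<in> triples H"
  shows "contains H F2 \<or> contains H F3"
proof -
  have V: "insert x P \<subseteq> verts H" "insert y P \<subseteq> verts H" "insert x Q \<subseteq> verts H"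
    using E H by (auto simp: triple_system_def)
  show ?thesis
  proof (cases "P \<inter> Q = {}")
    case False
    then obtain a p where a: "a \<in> P" "a \<in> Q" and P: "P = {a, p}" "p \<noteq> a"
      using PQ(1) by (auto simp: card_2_iff)
    obtain q where Q: "Q = {a, q}" "q \<noteq> a"
      using PQ(2) a by (auto simp: card_2_iff)
    define f :: "nat \<Rightarrow> 'a" where "f = (\<lambda>_. a)(0 := x, 1 := p, 2 := y, 3 := q)"
    have f: "f 0 = x" "f (Suc 0) = p" "f 2 = y" "f 3 = q" "f 4 = a"
      by (simp_all add: f_def)
    have "{x, y, a, p, q} \<subseteq> verts H"
      using V P Q by simp
    moreover have "inj_on f {0, 1, 2, 3, 4}"
      using xy PQ(3) P Q by (simp add: f) blast
    moreover have "{a, x, p} \<in> triples H" "{a, p, y} \<in> triples H"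
      "{a, y, q} \<in> triples H" "{a, q, x} \<in> triples H"
      using E P Q by (simp_all add: insert_commute)
    ultimately have "contains H F2"
      unfolding F2_def
      by (subst contains_iff_inj_map[OF triple_system_special_four_cycle H])
        (auto simp: verts_special_four_cycle triples_special_four_cycle f intro!: exI[of _ f])
    then show ?thesis ..
  next
    case True
    obtain a p where P: "P = {a, p}" "p \<noteq> a"
      using PQ(1) by (auto simp: card_2_iff)
    obtain b q where Q: "Q = {b, q}" "q \<noteq> b"
      using PQ(2) by (auto simp: card_2_iff)
    define f :: "nat \<Rightarrow> 'a" where "f = (\<lambda>_. b)(0 := x, 1 := p, 2 := y, 3 := q, 4 := a)"
    have f: "f 0 = x" "f (Suc 0) = p" "f 2 = y" "f 3 = q" "f 4 = a" "f 5 = b"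
      by (simp_all add: f_def)
    have "{x, y, a, b, p, q} \<subseteq> verts H"
      using V P Q by simp
    moreover have "inj_on f {0, 1, 2, 3, 4, 5}"
      using xy True P Q by (simp add: f) blast
    moreover have "{a, x, p} \<in> triples H" "{a, p, y} \<in> triples H"
      "{b, y, q} \<in> triples H" "{b, q, x} \<in> triples H"
      using E P Q by (simp_all add: insert_commute)
    ultimately have "contains H F3"
      unfolding F3_def
      by (subst contains_iff_inj_map[OF triple_system_special_four_cycle H])
        (auto simp: verts_special_four_cycle triples_special_four_cycle f intro!: exI[of _ f])
    then show ?thesis ..
  qed
qed

text \<open>Split every triple into a tip and a two-element base, and let one triple over each base be its
  representative. A representative is charged to its base; any other triple is charged to the pair
  formed by its own tip and the tip of the representative, which determines the base because the
  two tips have no other common base.\<close>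

lemma card_triples_le_square:
  assumes H: "triple_system H" and free: "\<not> contains H F2" "\<not> contains H F3"
  shows "card (triples H) \<le> (card (verts H))\<^sup>2"
proof -
  let ?V = "verts H" and ?E = "triples H"
  let ?pairs = "{P. P \<subseteq> ?V \<and> card P = 2}"
  have E: "e \<subseteq> ?V" "card e = 3" if "e \<in> ?E" for e
    using H that by (auto simp: triple_system_def)
  have fin: "finite ?V" using H by (simp add: triple_system_def)
  define tip :: "'a set \<Rightarrow> 'a" where "tip e = (SOME v. v \<in> e)" for e
  define base where "base e = e - {tip e}" for e
  have tip: "tip e \<in> e" if "e \<in> ?E" for e
    using E(2)[OF that] by (auto simp: tip_def some_in_eq)
  have tip_notin_base: "tip e \<notin> base e" for e
    by (simp add: base_def)
  have split: "insert (tip e) (base e) = e" if "e \<in> ?E" for e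
    using tip[OF that] by (auto simp: base_def)
  have card_base: "card (base e) = 2" if "e \<in> ?E" for e
    using tip[OF that] E(2)[OF that] by (simp add: base_def)
  define rep where "rep P = (SOME e. e \<in> ?E \<and> base e = P)" for P
  have rep: "rep (base e) \<in> ?E" "base (rep (base e)) = base e" if "e \<in> ?E" for e
    using someI[of "\<lambda>e'. e' \<in> ?E \<and> base e' = base e" e] that by (auto simp: rep_def)
  define R where "R = {e \<in> ?E. rep (base e) = e}"
  define charge where "charge e = {tip e, tip (rep (base e))}" for e
  have tip_neq: "tip (rep (base e)) \<noteq> tip e" if "e \<in> ?E - R" for e
    using that rep[of e] split[of e] split[of "rep (base e)"] by (auto simp: R_def)
  have base_unique: "base e = base e'"
    if e: "e \<in> ?E - R" and e': "e' \<in> ?E - R" and eq: "charge e = charge e'" for e e'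
  proof (rule ccontr)
    assume neq: "base e \<noteq> base e'"
    let ?x = "tip e" and ?y = "tip (rep (base e))"
    have compl: "insert ?x (base e) \<in> ?E" "insert ?y (base e) \<in> ?E"
      "insert (tip e') (base e') \<in> ?E" "insert (tip (rep (base e'))) (base e') \<in> ?E"
      using e e' split[of e] split[of e'] split[OF rep(1), of e] split[OF rep(1), of e']
        rep[of e] rep[of e'] by simp_all
    have tips: "?x \<notin> base e" "?y \<notin> base e" "tip e' \<notin> base e'" "tip (rep (base e')) \<notin> base e'"
      using e e' tip_notin_base[of "rep (base e)"] tip_notin_base[of "rep (base e')"]
        rep[of e] rep[of e'] tip_notin_base by simp_all
    \<comment> \<open>The unordered pairs of tips agree, so the roles of tip and tip of the representative may swap.\<close>
    have "?x = tip e' \<and> ?y = tip (rep (base e')) \<or> ?x = tip (rep (base e')) \<and> ?y = tip e'"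
      using eq by (auto simp: charge_def doubleton_eq_iff)
    then have "insert ?x (base e') \<in> ?E" "insert ?y (base e') \<in> ?E" "?x \<notin> base e'" "?y \<notin> base e'"
      using compl(3,4) tips(3,4) by auto
    then have "contains H F2 \<or> contains H F3"
      using common_completions_contain_F2_or_F3[OF H, of "base e" "base e'" ?x ?y]
        e e' card_base neq compl(1,2) tips(1,2) tip_neq[OF e] by simp
    then show False using free by simp
  qed
  have "inj_on base R"
    by (rule inj_on_inverseI[of _ rep]) (simp add: R_def)
  moreover have "base ` R \<subseteq> ?pairs"
    using E(1) card_base by (auto simp: R_def) (auto simp: base_def)
  ultimately have "card R \<le> card ?pairs"
    using fin by (intro card_inj_on_le) auto
  moreover have "card (?E - R) \<le> card ?pairs"
  proof (rule card_inj_on_le)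
    show "inj_on charge (?E - R)"
    proof (rule inj_onI)
      fix e e' assume e: "e \<in> ?E - R" "e' \<in> ?E - R" "charge e = charge e'"
      have "base e = base e'" using base_unique e by blast
      moreover from this have "tip e = tip e'"
        using e tip_neq by (auto simp: charge_def doubleton_eq_iff)
      ultimately show "e = e'" using split e by (metis DiffD1)
    qed
    show "charge ` (?E - R) \<subseteq> ?pairs"
    proof
      fix P assume "P \<in> charge ` (?E - R)"
      then obtain e where e: "e \<in> ?E - R" and P: "P = charge e" by blast
      have "tip e \<in> ?V" "tip (rep (base e)) \<in> ?V"
        using e tip E(1) rep by blast+
      with tip_neq[OF e] show "P \<in> ?pairs" by (simp add: P charge_def)
    qed
  qed (use fin in auto)
  moreover have "card ?pairs = card ?V choose 2"
    by (rule n_subsets[OF fin])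
  moreover have "card ?E \<le> card R + card (?E - R)"
  proof -
    have "?E = R \<union> (?E - R)" by (auto simp: R_def)
    then show ?thesis by (metis card_Un_le)
  qed
  moreover have "2 * (card ?V choose 2) \<le> (card ?V)\<^sup>2"
    by (simp add: choose_two power2_eq_square)
      (metis diff_le_self mult_le_mono2 order_trans times_div_less_eq_dividend)
  ultimately show ?thesis by linarith
qed

section \<open>A linear system without Pasch configurations\<close>

text \<open>The blocks \<open>[0, m)\<close>, \<open>[m, 2 m)\<close> and \<open>[2 m, 4 m)\<close> hold the rows, the columns and the sums.\<close>

definition addition_triples :: "nat \<Rightarrow> nat set set" where
  "addition_triples m = (\<lambda>(x, y). {x, m + y, 2 * m + (x + y)}) ` ({..<m} \<times> {..<m})"

definition block :: "nat \<Rightarrow> nat \<Rightarrow> nat" where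
  "block m v = (if v < m then 0 else if v < 2 * m then 1 else 2)"

text \<open>The entry of a vertex, with the sum counted negatively, so that the weights of every triple add
  up to zero.\<close>

definition weight :: "nat \<Rightarrow> nat \<Rightarrow> int" where
  "weight m v = (if v < m then int v else if v < 2 * m then int v - int m else 2 * int m - int v)"

lemma eq_if_same_block_weight:
  "block m u = block m v \<Longrightarrow> weight m u = weight m v \<Longrightarrow> u = v"
  by (auto simp: block_def weight_def split: if_splits)

text \<open>Since a triple meets each block once, the block numbers satisfy a linear equation just as the
  weights do. Block and weight together determine a vertex, so linearity and the absence of Pasch
  configurations reduce to solving these equations.\<close>

lemma addition_triples_sums:
  assumes "{a, b, c} \<in> addition_triples m" and "a \<noteq> b" "b \<noteq> c" "a \<noteq> c"
  shows "block m a + block m b + block m c = 3" "weight m a + weight m b + weight m c = 0"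
proof -
  obtain x y where xy: "x < m" "y < m" and abc: "{a, b, c} = {x, m + y, 2 * m + (x + y)}"
    using assms(1) by (auto simp: addition_triples_def)
  have distinct: "x \<noteq> m + y" "x \<noteq> 2 * m + (x + y)" "m + y \<noteq> 2 * m + (x + y)"
    using xy by auto
  have "block m a + block m b + block m c = sum (block m) {a, b, c}"
    using assms by simp
  also have "\<dots> = 3"
    unfolding abc using distinct xy by (simp add: block_def)
  finally show "block m a + block m b + block m c = 3" .
  have "weight m a + weight m b + weight m c = sum (weight m) {a, b, c}"
    using assms by simp
  also have "\<dots> = 0"
    unfolding abc using distinct xy by (simp add: weight_def)
  finally show "weight m a + weight m b + weight m c = 0" .
qed

lemma addition_triples_linear:
  assumes "{a, b, c} \<in> addition_triples m" "{a, b, d} \<in> addition_triples m"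
    and "a \<noteq> b" "a \<noteq> c" "b \<noteq> c" "a \<noteq> d" "b \<noteq> d"
  shows "c = d"
proof (rule eq_if_same_block_weight)
  note sums = addition_triples_sums[OF assms(1)] addition_triples_sums[OF assms(2)]
  show "block m c = block m d" "weight m c = weight m d"
    using sums assms(3-) by auto
qed

text \<open>Every vertex of a Pasch configuration lies on two of its triples. Adding the two equations for
  the triples through \<open>p\<close> and subtracting the two for the triples through \<open>r\<close> cancels all the other
  vertices, which leaves twice the difference between \<open>p\<close> and \<open>r\<close>.\<close>

lemma addition_triples_no_Pasch:
  assumes "{a, p, q} \<in> addition_triples m" "{b, q, r} \<in> addition_triples m"
    "{a, r, s} \<in> addition_triples m" "{b, s, p} \<in> addition_triples m"
    and "distinct [a, b, p, q, r, s]"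
  shows False
proof -
  have "block m a + block m p + block m q = 3" "block m b + block m q + block m r = 3"
    "block m a + block m r + block m s = 3" "block m b + block m s + block m p = 3"
    using assms by (auto dest!: addition_triples_sums(1))
  then have "block m p = block m r" by linarith
  moreover have "weight m a + weight m p + weight m q = 0" "weight m b + weight m q + weight m r = 0"
    "weight m a + weight m r + weight m s = 0" "weight m b + weight m s + weight m p = 0"
    using assms by (auto dest!: addition_triples_sums(2))
  then have "weight m p = weight m r" by linarith
  ultimately have "p = r" by (rule eq_if_same_block_weight)
  with assms(5) show False by simp
qed

lemma card_addition_triples: "card (addition_triples m) = m\<^sup>2"
proof -
  have "inj_on (\<lambda>(x, y). {x, m + y, 2 * m + (x + y)}) ({..<m} \<times> {..<m})"
  proof (clarsimp simp: inj_on_def)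
    fix x y x' y'
    assume xy: "x < m" "y < m" "x' < m" "y' < m"
      and eq: "{x, m + y, 2 * m + (x + y)} = {x', m + y', 2 * m + (x' + y')}"
    have "x \<in> {x', m + y', 2 * m + (x' + y')}" "m + y \<in> {x', m + y', 2 * m + (x' + y')}"
      unfolding eq[symmetric] by simp_all
    with xy show "x = x' \<and> y = y'" by auto
  qed
  then show ?thesis
    unfolding addition_triples_def by (simp add: card_image power2_eq_square)
qed

lemma triple_system_addition_triples:
  assumes "4 * m \<le> n"
  shows "triple_system ({..<n}, addition_triples m)"
  using assms by (auto simp: triple_system_def addition_triples_def card_insert_if)

text \<open>Two consecutive triples with the same apex share that apex and a base vertex, which linearity
  rules out.\<close>

lemma addition_triples_free_of_repeated_apex:
  assumes H: "triple_system (V, addition_triples m)" and cd: "4 \<le> c" "4 \<le> d"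
  shows "\<not> contains (V, addition_triples m) (special_four_cycle [4, 4, c, d])"
proof
  assume "contains (V, addition_triples m) (special_four_cycle [4, 4, c, d])"
  then obtain f :: "nat \<Rightarrow> nat" where inj: "inj_on f {0, 1, 2, 3, 4, 4, c, d}"
    and f: "{f 4, f 0, f 1} \<in> addition_triples m" "{f 4, f 1, f 2} \<in> addition_triples m"
    by (subst (asm) contains_iff_inj_map[OF triple_system_special_four_cycle H])
      (use cd in \<open>auto simp: verts_special_four_cycle triples_special_four_cycle\<close>)
  have inj': "inj_on f {0, 1, 2, 4}"
    using inj by (rule inj_on_subset) auto
  have "f 0 = f 2"
  proof (rule addition_triples_linear[of "f 4" "f 1"])
    show "{f 4, f 1, f 0} \<in> addition_triples m" using f(1) by (simp add: insert_commute)
  qed (use f inj' in \<open>auto simp: inj_on_def\<close>)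
  then show False using inj' by (auto simp: inj_on_def)
qed

lemma addition_triples_free_of_F4:
  assumes H: "triple_system (V, addition_triples m)"
  shows "\<not> contains (V, addition_triples m) F4"
proof
  assume "contains (V, addition_triples m) F4"
  then obtain f :: "nat \<Rightarrow> nat" where inj: "inj_on f {0, 1, 2, 3, 4, 5}"
    and f: "{f 4, f 0, f 1} \<in> addition_triples m" "{f 5, f 1, f 2} \<in> addition_triples m"
      "{f 4, f 2, f 3} \<in> addition_triples m" "{f 5, f 3, f 0} \<in> addition_triples m"
    unfolding F4_def
    by (subst (asm) contains_iff_inj_map[OF triple_system_special_four_cycle H])
      (auto simp: verts_special_four_cycle triples_special_four_cycle)
  show False
    by (rule addition_triples_no_Pasch[OF f]) (use inj in \<open>auto simp: inj_on_def\<close>)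
qed

section \<open>The order of magnitude\<close>

theorem proposition6:
  fixes \<A> :: "nat triple_sys set"
  assumes "{F2, F3} \<subseteq> \<A>" and "\<A> \<subseteq> {F2, F3, F4, F5, F7}"
  shows "(\<lambda>n. real (ex_number n \<A>)) \<in> \<Theta>(\<lambda>n. real n ^ 2)"
proof -
  define S where "S n = {card (triples H) | H :: nat triple_sys.
     triple_system H \<and> card (verts H) = n \<and> (\<forall>F \<in> \<A>. \<not> contains H F)}" for n
  have ex_number: "ex_number n \<A> = Max (S n)" for n
    by (simp add: ex_number_def S_def)
  have upper: "k \<le> n\<^sup>2" if "k \<in> S n" for k n
  proof -
    obtain H :: "nat triple_sys" where "triple_system H" "card (verts H) = n" "k = card (triples H)"
      and "\<forall>F \<in> \<A>. \<not> contains H F"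
      using \<open>k \<in> S n\<close> unfolding S_def by blast
    with assms(1) show ?thesis
      using card_triples_le_square[of H] by simp
  qed
  have fin: "finite (S n)" for n
    by (rule finite_subset[of _ "{..n\<^sup>2}"]) (use upper in auto)
  have mem: "(n div 4)\<^sup>2 \<in> S n" for n
  proof -
    let ?H = "({..<n}, addition_triples (n div 4))"
    have H: "triple_system ?H" by (rule triple_system_addition_triples) simp
    have "\<not> contains ?H F" if "F \<in> \<A>" for F
      using that assms(2) addition_triples_free_of_F4[OF H]
        addition_triples_free_of_repeated_apex[OF H]
      by (auto simp: F2_def F3_def F5_def F7_def)
    with H show ?thesis
      unfolding S_def by (intro CollectI exI[of _ ?H]) (simp add: card_addition_triples)
  qed
  have le: "ex_number n \<A> \<le> n\<^sup>2" for n
    unfolding ex_number using fin mem upper by (intro Max.boundedI) blast+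
  have ge: "(n div 4)\<^sup>2 \<le> ex_number n \<A>" for n
    unfolding ex_number by (rule Max_ge[OF fin mem])
  show ?thesis
  proof (rule bigthetaI)
    show "(\<lambda>n. real (ex_number n \<A>)) \<in> O(\<lambda>n. real n ^ 2)"
    proof (rule landau_o.bigI[of 1])
      show "\<forall>\<^sub>F n in at_top. norm (real (ex_number n \<A>)) \<le> 1 * norm (real n ^ 2)"
        using le by (simp flip: of_nat_power)
    qed simp
    show "(\<lambda>n. real (ex_number n \<A>)) \<in> \<Omega>(\<lambda>n. real n ^ 2)"
    proof (rule landau_omega.bigI[of "1 / 64"])
      show "\<forall>\<^sub>F n in at_top. norm (real (ex_number n \<A>)) \<ge> 1 / 64 * norm (real n ^ 2)"
      proof (rule eventually_at_top_linorderI[of 4])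
        fix n :: nat assume "4 \<le> n"
        \<comment> \<open>Rounding down costs at most a factor of two once the quotient is positive.\<close>
        then have "n \<le> 8 * (n div 4)"
          using div_mult_mod_eq[of n 4] mod_less_divisor[of 4 n] div_greater_zero_iff[of n 4]
          by linarith
        then have "n\<^sup>2 \<le> (8 * (n div 4))\<^sup>2" by (rule power_mono) simp
        also have "\<dots> \<le> 64 * ex_number n \<A>"
          using ge[of n] by (simp add: power_mult_distrib)
        finally have "real (n\<^sup>2) \<le> real (64 * ex_number n \<A>)" by (rule of_nat_mono)
        then show "norm (real (ex_number n \<A>)) \<ge> 1 / 64 * norm (real n ^ 2)" by simp
      qed
    qed simp
  qed
qed

end
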